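(* Let $d,m,k\in\mathbb{N}$. Let $\mathbb{X}=(X,\mathcal{B},\mu,(T_1,\dots,T_d))$ be a measure-preserving dynamical system, where $(X,\mathcal{B},\mu)$ is a nontrivial $\sigma$-finite measure space and $T_1,\dots,T_d$ are invertible, pairwise commuting measure-preserving transformations of $X$. Let $\mathcal{P}=(P_{i,j})_{i\in[d],\,j\in[m]}$ be a family of polynomials in $k$ variables with $P_{i,j}(\mathbb{Z}^k)\subseteq\mathbb{Z}$, and let $p=(p_0,p_1,\dots,p_m)\in(0,\infty)^{m+1}$ satisfy $\frac1{p_1}+\cdots+\frac1{p_m}=\frac1{p_0}$. Let $\mathcal{O}\colon\mathbb{R}^{\mathbb{N}}\to[0,\infty]$ be any map for which there exist Borel measurable maps $\mathcal{O}_K\colon\mathbb{R}^K\to[0,\infty)$, $K\in\mathbb{N}$, such that for every sequence $(a_n)_{n\in\mathbb{N}}\in\mathbb{R}^{\mathbb{N}}$ $$\mathcal{O}(a_n:n\in\mathbb{N})\ \ge\ \mathcal{O}_K(a_n:n\in[K])\quad\text{for all }K\in\mathbb{N},\qquad \mathcal{O}(a_n:n\in\mathbb{N})=\lim_{K\to\infty}\mathcal{O}_K(a_n:n\in[K]).$$ Then $$\mathcal{C}^{\mathcal{P}}_{\mathcal{O}}(\mathbb{X},p,\mathrm{s})\le \mathcal{C}^{\mathcal{P}}_{\mathcal{O}}(\mathbb{X}_d,p,\mathrm{s})\qquad\text{and}\qquad \mathcal{C}^{\mathcal{P}}_{\mathcal{O}}(\mathbb{X},p,\mathrm{w})\le \mathcal{C}^{\mathcal{P}}_{\mathcal{O}}(\mathbb{X}_d,p,\mathrm{w}),$$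 where $\mathbb{X}_d$ is the $d$-dimensional canonical system.
   Context: $\mathbb{N}=\{1,2,\dots\}$ and $[l]=\{1,\dots,l\}$. A measure space is nontrivial if it has a measurable subset of finite and strictly positive measure. A map $T\colon X\to X$ is measure-preserving if it is measurable and $\mu(T^{-1}(E))=\mu(E)$ for all $E\in\mathcal{B}$; invertible means bijective with measurable (hence measure-preserving) inverse. For an $m$-tuple $f=(f_1,\dots,f_m)$ of measurable functions $f_j\colon X\to\mathbb{R}$ and $N\in\mathbb{N}$, the averaging operator is $$A_N^{\mathcal{P}}f(x)=\frac{1}{N^k}\sum_{n\in[N]^k}\ \prod_{j\in[m]} f_j\big(T_1^{P_{1,j}(n)}\cdots T_d^{P_{d,j}(n)}x\big),\qquad x\in X.$$ $\mathcal{O}(A_N^{\mathcal{P}}f:N\in\mathbb{N})$ denotes the function $x\mapsto\mathcal{O}(A_N^{\mathcal{P}}f(x):N\in\mathbb{N})$ on $X$. For $q\in(0,\infty)$, $\|g\|_q=(\int_X|g|^q\,d\mu)^{1/q}$ and $\|g\|_{q,\infty}=\sup_{\lambda\in(0,\infty)}\lambda\,\mu(\{x\in X:|g(x)|\ge\lambda\})^{1/q}$. $\mathcal{C}^{\mathcal{P}}_{\mathcal{O}}(\mathbb{X},p,\mathrm{s})$ and $\mathcal{C}^{\mathcal{P}}_{\mathcal{O}}(\mathbb{X},p,\mathrm{w})$ denote the smallest constants $C\in[0,\infty]$ such that, respectively, $$\|\mathcal{O}(A_N^{\mathcal{P}}f:N\in\mathbb{N})\|_{p_0}\le C\prod_{j\in[m]}\|f_j\|_{p_j}\qquad\text{and}\qquad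 \|\mathcal{O}(A_N^{\mathcal{P}}f:N\in\mathbb{N})\|_{p_0,\infty}\le C\prod_{j\in[m]}\|f_j\|_{p_j}$$ hold for all $f\in L^{p_1}(\mathbb{X})\times\cdots\times L^{p_m}(\mathbb{X})$ (the constant is $\infty$ if no finite $C$ works). The $d$-dimensional canonical system $\mathbb{X}_d$ is $\mathbb{Z}^d$ with the $\sigma$-algebra of all subsets, counting measure, and the $d$ shifts $\mathcal{T}_{d,i}(l_1,\dots,l_d)=(l_1,\dots,l_{i-1},l_i+1,l_{i+1},\dots,l_d)$, $i\in[d]$; the constants for $\mathbb{X}_d$ are defined by the same formulas. *)

theory Defs
  imports "HOL-Analysis.Analysis" "HOL-Library.Poly_Mapping"
begin

text \<open>
  The set \<open>\<nat> = {1, 2, \<dots>}\<close> of index values is rendered by \<^typ>\<open>nat\<close> together with guards such as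
  \<open>N \<ge> 1\<close>. Tuples indexed by \<open>[l]\<close> are functions on \<^typ>\<open>nat\<close> of which only the arguments in
  \<^term>\<open>{1..l}\<close> matter; where the set of all tuples matters, they are extensional functions.
\<close>

section \<open>Measure-preserving systems\<close>

definition nontrivial_measure :: "'a measure \<Rightarrow> bool" where
  "nontrivial_measure M \<longleftrightarrow> (\<exists>E \<in> sets M. 0 < emeasure M E \<and> emeasure M E < \<infinity>)"

definition measure_preserving_map :: "'a measure \<Rightarrow> ('a \<Rightarrow> 'a) \<Rightarrow> bool" where
  "measure_preserving_map M T \<longleftrightarrow>
     T \<in> measurable M M \<and> (\<forall>E \<in> sets M. emeasure M (T -` E \<inter> space M) = emeasure M E)"

definition invertible_mp_map :: "'a measure \<Rightarrow> ('a \<Rightarrow> 'a) \<Rightarrow> bool" where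
  "invertible_mp_map M T \<longleftrightarrow>
     measure_preserving_map M T \<and> bij_betw T (space M) (space M) \<and>
     inv_into (space M) T \<in> measurable M M"

definition mp_system :: "'a measure \<Rightarrow> nat \<Rightarrow> (nat \<Rightarrow> 'a \<Rightarrow> 'a) \<Rightarrow> bool" where
  "mp_system M d T \<longleftrightarrow>
     sigma_finite_measure M \<and> nontrivial_measure M \<and>
     (\<forall>i \<in> {1..d}. invertible_mp_map M (T i)) \<and>
     (\<forall>i \<in> {1..d}. \<forall>j \<in> {1..d}. \<forall>x \<in> space M. T i (T j x) = T j (T i x))"

definition int_iterate :: "'a set \<Rightarrow> ('a \<Rightarrow> 'a) \<Rightarrow> int \<Rightarrow> 'a \<Rightarrow> 'a" where
  "int_iterate S T n =
     (if n \<ge> 0 then T ^^ nat n else inv_into S T ^^ nat (- n))"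

text \<open>\<open>multi_iterate S d T e x = T\<^sub>1\<^bsup>e\<^sub>1\<^esup> (\<dots> (T\<^sub>d\<^bsup>e\<^sub>d\<^esup> x))\<close>.\<close>

definition multi_iterate ::
    "'a set \<Rightarrow> nat \<Rightarrow> (nat \<Rightarrow> 'a \<Rightarrow> 'a) \<Rightarrow> (nat \<Rightarrow> int) \<Rightarrow> 'a \<Rightarrow> 'a" where
  "multi_iterate S d T e x = foldr (\<lambda>i. int_iterate S (T i) (e i)) [1..<Suc d] x"

definition canonical_measure :: "nat \<Rightarrow> (nat \<Rightarrow> int) measure" where
  "canonical_measure d = count_space ({1..d} \<rightarrow>\<^sub>E UNIV)"

definition canonical_shift :: "nat \<Rightarrow> (nat \<Rightarrow> int) \<Rightarrow> (nat \<Rightarrow> int)" where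
  "canonical_shift i l = l(i := l i + 1)"


section \<open>Integer-valued polynomials in several variables\<close>

text \<open>
  A polynomial maps each monomial (a finitely supported function from variable indices to exponents)
  to its coefficient. An integer-valued polynomial automatically has rational coefficients, so taking
  them real is no restriction.
\<close>

type_synonym real_mpoly = "(nat \<Rightarrow>\<^sub>0 nat) \<Rightarrow>\<^sub>0 real"

definition poly_in_vars :: "nat \<Rightarrow> real_mpoly \<Rightarrow> bool" where
  "poly_in_vars k P \<longleftrightarrow> (\<forall>a \<in> Poly_Mapping.keys P. Poly_Mapping.keys a \<subseteq> {1..k})"

definition mpoly_eval :: "real_mpoly \<Rightarrow> (nat \<Rightarrow> real) \<Rightarrow> real" where
  "mpoly_eval P x =
     (\<Sum>a \<in> Poly_Mapping.keys P. Poly_Mapping.lookup P a *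
        (\<Prod>i \<in> Poly_Mapping.keys a. x i ^ Poly_Mapping.lookup a i))"

definition integer_valued :: "real_mpoly \<Rightarrow> bool" where
  "integer_valued P \<longleftrightarrow> (\<forall>n :: nat \<Rightarrow> int. mpoly_eval P (\<lambda>i. of_int (n i)) \<in> \<int>)"

text \<open>The floor only changes the type: it is applied to integer-valued polynomials.\<close>

definition mpoly_int :: "real_mpoly \<Rightarrow> (nat \<Rightarrow> nat) \<Rightarrow> int" where
  "mpoly_int P n = \<lfloor>mpoly_eval P (\<lambda>i. of_nat (n i))\<rfloor>"


section \<open>Averages, norms and optimal constants\<close>

definition poly_average ::
    "'a measure \<Rightarrow> nat \<Rightarrow> (nat \<Rightarrow> 'a \<Rightarrow> 'a) \<Rightarrow> nat \<Rightarrow> nat \<Rightarrow> (nat \<Rightarrow> nat \<Rightarrow> real_mpoly) \<Rightarrow>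
     (nat \<Rightarrow> 'a \<Rightarrow> real) \<Rightarrow> nat \<Rightarrow> 'a \<Rightarrow> real" where
  "poly_average M d T m k P f N x =
     (1 / real N ^ k) *
     (\<Sum>n \<in> {1..k} \<rightarrow>\<^sub>E {1..N}. \<Prod>j \<in> {1..m}.
        f j (multi_iterate (space M) d T (\<lambda>i. mpoly_int (P i j) n) x))"

text \<open>\<open>t\<^bsup>a\<^esup>\<close> for \<open>t \<in> [0, \<infinity>]\<close> and \<open>a > 0\<close>.\<close>

definition ennpow :: "ennreal \<Rightarrow> real \<Rightarrow> ennreal" where
  "ennpow t a = (if t = \<infinity> then \<infinity> else ennreal (enn2real t powr a))"

definition strong_norm :: "'a measure \<Rightarrow> real \<Rightarrow> ('a \<Rightarrow> ennreal) \<Rightarrow> ennreal" where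
  "strong_norm M q g = ennpow (\<integral>\<^sup>+ x. ennpow (g x) q \<partial>M) (1 / q)"

definition weak_norm :: "'a measure \<Rightarrow> real \<Rightarrow> ('a \<Rightarrow> ennreal) \<Rightarrow> ennreal" where
  "weak_norm M q g =
     (SUP t \<in> {0<..}. ennreal t * ennpow (emeasure M {x \<in> space M. ennreal t \<le> g x}) (1 / q))"

definition Lp_norm :: "'a measure \<Rightarrow> real \<Rightarrow> ('a \<Rightarrow> real) \<Rightarrow> ennreal" where
  "Lp_norm M q f = strong_norm M q (\<lambda>x. ennreal \<bar>f x\<bar>)"

definition Lp_space :: "'a measure \<Rightarrow> real \<Rightarrow> ('a \<Rightarrow> real) set" where
  "Lp_space M q = {f \<in> borel_measurable M. Lp_norm M q f < \<infinity>}"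

text \<open>
  The optimal constant for a norm functional \<open>nrm\<close>, which is \<^const>\<open>strong_norm\<close> or \<^const>\<open>weak_norm\<close>
  below. The infimum is attained when it is finite. Since \<open>\<infinity> \<cdot> 0 = 0\<close> in \<^typ>\<open>ennreal\<close>, the value
  \<open>\<infinity>\<close> need not satisfy the inequality itself, but the infimum is \<open>\<infinity>\<close> exactly if no finite \<open>C\<close> does.
\<close>

definition optimal_constant ::
    "('a measure \<Rightarrow> real \<Rightarrow> ('a \<Rightarrow> ennreal) \<Rightarrow> ennreal) \<Rightarrow>
     ((nat \<Rightarrow> real) \<Rightarrow> ennreal) \<Rightarrow> 'a measure \<Rightarrow> nat \<Rightarrow> (nat \<Rightarrow> 'a \<Rightarrow> 'a) \<Rightarrow>
     nat \<Rightarrow> nat \<Rightarrow> (nat \<Rightarrow> nat \<Rightarrow> real_mpoly) \<Rightarrow> (nat \<Rightarrow> real) \<Rightarrow> ennreal" where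
  "optimal_constant nrm \<O> M d T m k P p =
     Inf {C. \<forall>f. (\<forall>j \<in> {1..m}. f j \<in> Lp_space M (p j)) \<longrightarrow>
            nrm M (p 0) (\<lambda>x. \<O> (\<lambda>N. poly_average M d T m k P f N x))
              \<le> C * (\<Prod>j \<in> {1..m}. Lp_norm M (p j) (f j))}"

definition strong_constant ::
    "((nat \<Rightarrow> real) \<Rightarrow> ennreal) \<Rightarrow> 'a measure \<Rightarrow> nat \<Rightarrow> (nat \<Rightarrow> 'a \<Rightarrow> 'a) \<Rightarrow>
     nat \<Rightarrow> nat \<Rightarrow> (nat \<Rightarrow> nat \<Rightarrow> real_mpoly) \<Rightarrow> (nat \<Rightarrow> real) \<Rightarrow> ennreal" where
  "strong_constant = optimal_constant strong_norm"

definition weak_constant ::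
    "((nat \<Rightarrow> real) \<Rightarrow> ennreal) \<Rightarrow> 'a measure \<Rightarrow> nat \<Rightarrow> (nat \<Rightarrow> 'a \<Rightarrow> 'a) \<Rightarrow>
     nat \<Rightarrow> nat \<Rightarrow> (nat \<Rightarrow> nat \<Rightarrow> real_mpoly) \<Rightarrow> (nat \<Rightarrow> real) \<Rightarrow> ennreal" where
  "weak_constant = optimal_constant weak_norm"

text \<open>
  A functional on \<open>\<real>\<^bsup>\<nat>\<^esup>\<close> is applied to sequences \<open>a\<close> of type \<^typ>\<open>nat \<Rightarrow> real\<close>. Their entry at
  \<open>0\<close> carries no information: the second condition below forces \<open>\<O> a\<close> not to depend on it.
\<close>

definition finitary_limit :: "((nat \<Rightarrow> real) \<Rightarrow> ennreal) \<Rightarrow> bool" where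
  "finitary_limit \<O> \<longleftrightarrow>
     (\<exists>\<O>' :: nat \<Rightarrow> (nat \<Rightarrow> real) \<Rightarrow> real.
        (\<forall>K \<ge> 1. \<O>' K \<in> borel_measurable (Pi\<^sub>M {1..K} (\<lambda>_. borel)) \<and>
                 (\<forall>b \<in> {1..K} \<rightarrow>\<^sub>E UNIV. 0 \<le> \<O>' K b)) \<and>
        (\<forall>a. (\<forall>K \<ge> 1. ennreal (\<O>' K (restrict a {1..K})) \<le> \<O> a) \<and>
             (\<lambda>K. ennreal (\<O>' K (restrict a {1..K}))) \<longlonglongrightarrow> \<O> a))"

end

theory Submission
  imports Defs
begin

text \<open>
  This is Calderon's transference principle. Along the orbit of a point \<open>x\<close> the averages of the system
  are averages on the lattice: with \<open>T\<^bsup>l\<^esup> = T\<^sub>1\<^bsup>l\<^sub>1\<^esup> \<dots> T\<^sub>d\<^bsup>l\<^sub>d\<^esup>\<close> and \<open>F\<^sub>j l = f\<^sub>j (T\<^bsup>l\<^esup> x)\<close>, the average of the \<open>f\<^sub>j\<close> at \<open>T\<^bsup>l\<^esup> x\<close>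
  is the average of the \<open>F\<^sub>j\<close> at \<open>l\<close>. The \<open>F\<^sub>j\<close> need not lie in any \<open>L\<^sup>p\<close> space, but the first \<open>K\<close> averages
  only see shifts by some bounded amount \<open>L\<close>, so for \<open>l\<close> in the box of radius \<open>R\<close> they do not change when
  the \<open>F\<^sub>j\<close> are cut off outside the box of radius \<open>R + L\<close> (\<open>poly_average_orbit_truncation\<close>). The inequality
  on the lattice, applied to these finitely supported functions, bounds a sum over the small box by a
  product of powers of sums over the large box. Integrating over \<open>x\<close>, using invariance of the measure on
  both sides and Hoelder's inequality for the product on the right, gives the wanted inequality up to
  the ratio of the numbers of points of the two boxes, because the exponents \<open>p\<^sub>0 / p\<^sub>j\<close> sum to \<open>1\<close>. The
  ratio tends to \<open>1\<close> as \<open>R \<rightarrow> \<infinity>\<close> while \<open>L\<close> stays fixed (\<open>nn_integral_le_of_box_sums_le\<close>). Finally \<open>K \<rightarrow> \<infinity>\<close> by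
  Fatou's lemma.

  The strong and the weak inequality are treated at once. Raised to the power \<open>p\<^sub>0\<close>, each says that
  \<open>\<integral> \<Phi>(\<O>(\<dots>))\<close> is bounded by a constant times the product of the \<open>\<parallel>f\<^sub>j\<parallel>\<^bsup>p\<^sub>0\<^esup>\<close>: for one function \<open>\<Phi>(y) = y\<^bsup>p\<^sub>0\<^esup>\<close>
  in the strong case, and for all \<open>\<Phi>(y) = t\<^bsup>p\<^sub>0\<^esup> \<cdot> 1(y > t)\<close> with \<open>t > 0\<close> in the weak case. The argument
  above only uses that \<open>\<Phi>\<close> is nondecreasing, for the comparison of \<open>\<O>\<close> with its finite approximations,
  and lower semicontinuous, for Fatou's lemma; this is the lemma \<open>transference\<close>.
\<close>

section \<open>Iterates of commuting bijections\<close>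

lemma int_iterate_mem:
  assumes "bij_betw T S S" "x \<in> S"
  shows "int_iterate S T n x \<in> S"
proof -
  have "(T ^^ k) x \<in> S" for k
    by (rule bij_betw_apply[OF bij_betw_funpow[OF assms(1)] assms(2)])
  moreover have "(inv_into S T ^^ k) x \<in> S" for k
    by (rule bij_betw_apply[OF bij_betw_funpow[OF bij_betw_inv_into[OF assms(1)]] assms(2)])
  ultimately show ?thesis by (simp add: int_iterate_def)
qed

lemma int_iterate_succ:
  assumes "bij_betw T S S" "x \<in> S"
  shows "int_iterate S T (n + 1) x = T (int_iterate S T n x)"
proof (cases "n \<ge> 0")
  case True
  then have "nat (n + 1) = Suc (nat n)" by simp
  then show ?thesis using True by (simp add: int_iterate_def)
next
  case False
  define k where "k = nat (- n - 1)"
  have k: "n = - int (Suc k)" using False by (simp add: k_def)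
  have "(inv_into S T ^^ k) x \<in> S"
    by (rule bij_betw_apply[OF bij_betw_funpow[OF bij_betw_inv_into[OF assms(1)]] assms(2)])
  then have "T (inv_into S T ((inv_into S T ^^ k) x)) = (inv_into S T ^^ k) x"
    using assms(1) by (simp add: bij_betw_inv_into_right)
  moreover have "int_iterate S T n x = inv_into S T ((inv_into S T ^^ k) x)"
  proof -
    have "nat (- n) = Suc k" "\<not> 0 \<le> n" using k by auto
    then show ?thesis by (simp only: int_iterate_def if_False funpow.simps comp_apply)
  qed
  moreover have "int_iterate S T (n + 1) x = (inv_into S T ^^ k) x"
  proof -
    have "nat (- (n + 1)) = k" "0 \<le> n + 1 \<Longrightarrow> k = 0 \<and> n + 1 = 0" using k by auto
    then show ?thesis unfolding int_iterate_def by (cases "0 \<le> n + 1") auto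
  qed
  ultimately show ?thesis by simp
qed

lemma int_iterate_0 [simp]: "int_iterate S T 0 x = x"
  by (simp add: int_iterate_def)

text \<open>
  Induction on an integer exponent has to go down as well as up; injectivity makes one recursion
  equation enough for both directions. The laws for iterates below follow by exhibiting the other
  side as a solution \<open>\<phi>\<close>, so that inverses never have to be mentioned.
\<close>

lemma int_iterate_unique:
  assumes T: "bij_betw T S S" and "\<phi> 0 = x" "x \<in> S"
    and in_S: "\<And>n. \<phi> n \<in> S" and step: "\<And>n. \<phi> (n + 1) = T (\<phi> n)"
  shows "int_iterate S T n x = \<phi> n"
proof (induction n rule: int_induct[where k = 0])
  case base
  then show ?case by (simp add: assms)
next
  case (step1 i)
  then show ?case by (simp add: int_iterate_succ assms)
next
  case (step2 i)
  have "T (int_iterate S T (i - 1) x) = T (\<phi> (i - 1))"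
    using int_iterate_succ[OF T \<open>x \<in> S\<close>, of "i - 1"] step[of "i - 1"] step2 by simp
  then show ?case
    by (rule inj_onD[OF bij_betw_imp_inj_on[OF T] _ int_iterate_mem[OF T \<open>x \<in> S\<close>] in_S])
qed

lemma int_iterate_add:
  assumes "bij_betw T S S" "x \<in> S"
  shows "int_iterate S T (a + b) x = int_iterate S T a (int_iterate S T b x)"
proof (rule int_iterate_unique[where \<phi> = "\<lambda>a. int_iterate S T (a + b) x", symmetric])
  show "int_iterate S T (n + 1 + b) x = T (int_iterate S T (n + b) x)" for n
    using int_iterate_succ[OF assms, of "n + b"] by (simp add: add_ac)
qed (use assms in \<open>auto intro: int_iterate_mem\<close>)

lemma int_iterate_commute1:
  assumes T: "bij_betw T S S" and U: "\<And>x. x \<in> S \<Longrightarrow> U x \<in> S"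
    and TU: "\<And>x. x \<in> S \<Longrightarrow> T (U x) = U (T x)" and x: "x \<in> S"
  shows "int_iterate S T n (U x) = U (int_iterate S T n x)"
  by (rule int_iterate_unique[where \<phi> = "\<lambda>n. U (int_iterate S T n x)", OF T])
     (simp_all add: U TU x T int_iterate_mem int_iterate_succ)

lemma int_iterate_commute:
  assumes "bij_betw T S S" "bij_betw U S S"
    and "\<And>x. x \<in> S \<Longrightarrow> T (U x) = U (T x)" and "x \<in> S"
  shows "int_iterate S T a (int_iterate S U b x) = int_iterate S U b (int_iterate S T a x)"
proof (rule int_iterate_commute1[OF assms(1) _ _ assms(4)])
  show "T (int_iterate S U b y) = int_iterate S U b (T y)" if "y \<in> S" for y
    by (rule int_iterate_commute1[symmetric])
       (use assms that in \<open>simp_all add: bij_betw_apply\<close>)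
qed (rule int_iterate_mem[OF assms(2)])

lemma foldr_int_iterate_mem:
  assumes "\<And>i. i \<in> set is \<Longrightarrow> bij_betw (T i) S S" "x \<in> S"
  shows "foldr (\<lambda>i. int_iterate S (T i) (e i)) is x \<in> S"
  using assms by (induction "is") (auto intro: int_iterate_mem)

lemma foldr_int_iterate_commute:
  assumes U: "bij_betw U S S" and "x \<in> S" and "\<And>i. i \<in> set is \<Longrightarrow> bij_betw (T i) S S"
    and "\<And>i x. i \<in> set is \<Longrightarrow> x \<in> S \<Longrightarrow> U (T i x) = T i (U x)"
  shows "int_iterate S U a (foldr (\<lambda>i. int_iterate S (T i) (e i)) is x) =
         foldr (\<lambda>i. int_iterate S (T i) (e i)) is (int_iterate S U a x)"
  using assms(3,4)
proof (induction "is")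
  case (Cons i "is")
  have "foldr (\<lambda>i. int_iterate S (T i) (e i)) is x \<in> S"
    using Cons.prems \<open>x \<in> S\<close> by (intro foldr_int_iterate_mem) auto
  then have "int_iterate S U a (foldr (\<lambda>i. int_iterate S (T i) (e i)) (i # is) x) =
      int_iterate S (T i) (e i) (int_iterate S U a (foldr (\<lambda>i. int_iterate S (T i) (e i)) is x))"
    using Cons.prems int_iterate_commute[OF U, of "T i"] by simp
  also have "int_iterate S U a (foldr (\<lambda>i. int_iterate S (T i) (e i)) is x) =
      foldr (\<lambda>i. int_iterate S (T i) (e i)) is (int_iterate S U a x)"
    using Cons.prems by (intro Cons.IH) auto
  finally show ?case by simp
qed simp

lemma foldr_int_iterate_add:
  assumes "x \<in> S" and "\<And>i. i \<in> set is \<Longrightarrow> bij_betw (T i) S S"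
    and "\<And>i j x. i \<in> set is \<Longrightarrow> j \<in> set is \<Longrightarrow> x \<in> S \<Longrightarrow> T i (T j x) = T j (T i x)"
  shows "foldr (\<lambda>i. int_iterate S (T i) (a i + b i)) is x =
         foldr (\<lambda>i. int_iterate S (T i) (a i)) is (foldr (\<lambda>i. int_iterate S (T i) (b i)) is x)"
  using assms(2,3)
proof (induction "is")
  case (Cons i "is")
  let ?F = "\<lambda>e. foldr (\<lambda>i. int_iterate S (T i) (e i)) is"
  have mem: "?F e y \<in> S" if "y \<in> S" for e y
    using that Cons.prems by (intro foldr_int_iterate_mem) auto
  have bij: "bij_betw (T i) S S" using Cons.prems by simp
  have "int_iterate S (T i) (a i + b i) (?F a (?F b x)) =
      int_iterate S (T i) (a i) (int_iterate S (T i) (b i) (?F a (?F b x)))"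
    using bij mem \<open>x \<in> S\<close> by (simp add: int_iterate_add)
  also have "int_iterate S (T i) (b i) (?F a (?F b x)) = ?F a (int_iterate S (T i) (b i) (?F b x))"
    using bij mem \<open>x \<in> S\<close> Cons.prems by (intro foldr_int_iterate_commute) simp_all
  finally show ?case
    using Cons.IH Cons.prems by simp
qed simp

text \<open>
  The iterates form an action of the group \<open>\<int>\<^sup>d\<close>: this is where commutativity of the maps enters.
\<close>

lemma multi_iterate_add:
  assumes "mp_system M d T" "x \<in> space M"
  shows "multi_iterate (space M) d T (\<lambda>i. a i + b i) x =
         multi_iterate (space M) d T a (multi_iterate (space M) d T b x)"
  unfolding multi_iterate_def
proof (rule foldr_int_iterate_add[OF assms(2)])
  fix i j y assume "i \<in> set [1..<Suc d]" "j \<in> set [1..<Suc d]" "y \<in> space M"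
  then show "T i (T j y) = T j (T i y)"
    using assms(1) unfolding mp_system_def by (auto simp only: set_upt atLeastLessThanSuc_atLeastAtMost)
next
  fix i assume "i \<in> set [1..<Suc d]"
  then show "bij_betw (T i) (space M) (space M)"
    using assms(1) unfolding mp_system_def invertible_mp_map_def
    by (auto simp only: set_upt atLeastLessThanSuc_atLeastAtMost)
qed

lemma multi_iterate_restrict:
  "multi_iterate S d T (restrict e {1..d}) x = multi_iterate S d T e x"
  unfolding multi_iterate_def by (intro foldr_cong) auto

section \<open>Invariance of the measure under iterates\<close>

lemma measure_preserving_map_id: "measure_preserving_map M (\<lambda>x. x)"
  by (auto simp: measure_preserving_map_def Int_absorb2 sets.sets_into_space)

lemma measure_preserving_map_iff_distr:
  "measure_preserving_map M T \<longleftrightarrow> T \<in> measurable M M \<and> distr M M T = M"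
proof safe
  assume "measure_preserving_map M T"
  then show "T \<in> measurable M M" "distr M M T = M"
    by (auto simp: measure_preserving_map_def emeasure_distr intro!: measure_eqI)
next
  assume "T \<in> measurable M M" "distr M M T = M"
  then show "measure_preserving_map M T"
    unfolding measure_preserving_map_def by (metis emeasure_distr)
qed

lemma measure_preserving_map_comp:
  assumes "measure_preserving_map M T" "measure_preserving_map M U"
  shows "measure_preserving_map M (\<lambda>x. T (U x))"
  using assms distr_distr[of T M M U M]
  by (auto simp: measure_preserving_map_iff_distr comp_def intro: measurable_compose)

lemma measure_preserving_map_funpow:
  assumes "measure_preserving_map M T"
  shows "measure_preserving_map M (T ^^ n)"
proof (induction n)
  case 0
  then show ?case using measure_preserving_map_id by (simp add: id_def)
next
  case (Suc n)
  then show ?case using measure_preserving_map_comp[OF assms Suc] by (simp add: comp_def)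
qed

text \<open>
  Since the measure is its own image under \<open>T\<close>, its image under the inverse is its image under the
  composition of both maps, which is the identity.
\<close>

lemma measure_preserving_map_inv:
  assumes "invertible_mp_map M T"
  shows "measure_preserving_map M (inv_into (space M) T)"
proof -
  let ?U = "inv_into (space M) T"
  have T: "measure_preserving_map M T" "bij_betw T (space M) (space M)" "?U \<in> measurable M M"
    using assms by (auto simp: invertible_mp_map_def)
  have "distr M M ?U = distr (distr M M T) M ?U"
    using T by (simp add: measure_preserving_map_iff_distr)
  also have "\<dots> = distr M M (?U \<circ> T)"
    using T by (intro distr_distr) (auto simp: measure_preserving_map_iff_distr)
  also have "\<dots> = distr M M (\<lambda>x. x)"
    using T by (intro distr_cong) (auto simp: bij_betw_inv_into_left)
  also have "\<dots> = M" by (simp add: distr_id)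
  finally show ?thesis using T by (simp add: measure_preserving_map_iff_distr)
qed

lemma measure_preserving_int_iterate:
  assumes "invertible_mp_map M T"
  shows "measure_preserving_map M (int_iterate (space M) T n)"
  using assms measure_preserving_map_inv[OF assms]
  by (auto simp: int_iterate_def invertible_mp_map_def intro!: measure_preserving_map_funpow)

lemma measure_preserving_multi_iterate:
  assumes "\<And>i. i \<in> {1..d} \<Longrightarrow> invertible_mp_map M (T i)"
  shows "measure_preserving_map M (multi_iterate (space M) d T e)"
proof -
  have "measure_preserving_map M (foldr (\<lambda>i. int_iterate (space M) (T i) (e i)) is)"
    if "\<And>i. i \<in> set is \<Longrightarrow> invertible_mp_map M (T i)" for "is"
    using that
  proof (induction "is")
    case Nil
    then show ?case using measure_preserving_map_id by (simp add: id_def)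
  next
    case (Cons i "is")
    then show ?case
      using measure_preserving_map_comp[OF measure_preserving_int_iterate Cons.IH]
      by (simp add: comp_def)
  qed
  from this[of "[1..<Suc d]"] show ?thesis
    unfolding multi_iterate_def[abs_def] using assms by (simp del: upt_Suc One_nat_def)
qed

lemma nn_integral_measure_preserving:
  assumes "measure_preserving_map M T" "g \<in> borel_measurable M"
  shows "(\<integral>\<^sup>+x. g (T x) \<partial>M) = (\<integral>\<^sup>+x. g x \<partial>M)"
  using assms nn_integral_distr[of T M M g] by (simp add: measure_preserving_map_iff_distr)

section \<open>The canonical system acts by translations\<close>

lemma canonical_shift_bij:
  assumes "i \<in> {1..d}"
  shows "bij_betw (canonical_shift i) ({1..d} \<rightarrow>\<^sub>E UNIV) ({1..d} \<rightarrow>\<^sub>E UNIV)"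
  using assms
  by (intro bij_betw_byWitness[where f' = "\<lambda>l. l(i := l i - 1)"])
     (auto simp: canonical_shift_def PiE_iff extensional_def simp del: One_nat_def)

lemma int_iterate_canonical_shift:
  assumes "i \<in> {1..d}" "l \<in> {1..d} \<rightarrow>\<^sub>E UNIV"
  shows "int_iterate ({1..d} \<rightarrow>\<^sub>E UNIV) (canonical_shift i) n l = l(i := l i + n)"
proof (rule int_iterate_unique[OF canonical_shift_bij[OF assms(1)]])
  show "l(i := l i + n) \<in> {1..d} \<rightarrow>\<^sub>E UNIV" for n
    using assms by (auto simp: PiE_iff extensional_def simp del: One_nat_def)
qed (use assms(2) in \<open>auto simp: canonical_shift_def\<close>)

lemma multi_iterate_canonical_shift:
  assumes l: "l \<in> {1..d} \<rightarrow>\<^sub>E UNIV"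
  shows "multi_iterate ({1..d} \<rightarrow>\<^sub>E UNIV) d canonical_shift e l = (\<lambda>i\<in>{1..d}. l i + e i)"
proof -
  let ?S = "{1..d} \<rightarrow>\<^sub>E (UNIV :: int set)"
  have "foldr (\<lambda>i. int_iterate ?S (canonical_shift i) (e i)) is l =
      (\<lambda>i. if i \<in> set is then l i + e i else l i)" if "distinct is" "set is \<subseteq> {1..d}" for "is"
    using that
  proof (induction "is")
    case (Cons i "is")
    have "(\<lambda>i. if i \<in> set is then l i + e i else l i) \<in> ?S"
      using Cons.prems l by (auto simp: PiE_iff extensional_def)
    then show ?case
      using Cons by (auto simp: int_iterate_canonical_shift simp del: One_nat_def)
  qed simp
  from this[of "[1..<Suc d]"]
  have "multi_iterate ?S d canonical_shift e l = (\<lambda>i. if i \<in> {1..d} then l i + e i else l i)"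
    unfolding multi_iterate_def by (simp add: atLeastLessThanSuc_atLeastAtMost del: upt_Suc One_nat_def)
  also have "\<dots> = (\<lambda>i\<in>{1..d}. l i + e i)"
    using PiE_arb[OF l] by (auto simp: restrict_def fun_eq_iff simp del: One_nat_def)
  finally show ?thesis .
qed

section \<open>Powers of extended nonnegative reals\<close>

lemma ennpow_ennreal: "0 \<le> r \<Longrightarrow> ennpow (ennreal r) a = ennreal (r powr a)"
  by (simp add: ennpow_def)

lemma ennpow_top [simp]: "ennpow top a = top"
  by (simp add: ennpow_def)

lemma ennpow_0 [simp]: "ennpow 0 a = 0"
  by (simp add: ennpow_def)

lemma ennpow_less_top_iff [simp]: "ennpow t a < top \<longleftrightarrow> t < top"
  by (auto simp: ennpow_def less_top)

lemma ennpow_one [simp]: "ennpow t 1 = t"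
  by (cases t) (auto simp: ennpow_ennreal)

lemma ennpow_ennpow: "ennpow (ennpow t a) b = ennpow t (a * b)"
  by (cases t) (auto simp: ennpow_ennreal powr_powr)

lemma ennpow_mono:
  assumes "a > 0" "s \<le> t"
  shows "ennpow s a \<le> ennpow t a"
  using assms
  by (cases s; cases t) (auto simp: ennpow_ennreal powr_mono2 top_unique intro!: ennreal_leI)

lemma ennpow_le_iff:
  assumes "a > 0"
  shows "ennpow s a \<le> ennpow t a \<longleftrightarrow> s \<le> t"
  using ennpow_mono[OF assms, of s t] ennpow_mono[of "1 / a" "ennpow s a" "ennpow t a"] assms
  by (auto simp: ennpow_ennpow)

lemma ennpow_less_iff:
  assumes "a > 0"
  shows "ennpow s a < ennpow t a \<longleftrightarrow> s < t"
  using ennpow_le_iff[OF assms, of t s] by (simp only: not_le[symmetric])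

lemma ennpow_inverse_le_iff:
  assumes "a > 0"
  shows "ennpow s (1 / a) \<le> t \<longleftrightarrow> s \<le> ennpow t a"
  using ennpow_le_iff[OF assms, of "ennpow s (1 / a)" t] assms by (simp add: ennpow_ennpow)

lemma ennpow_eq_0_iff: "ennpow t a = 0 \<longleftrightarrow> t = 0"
  by (cases t) (auto simp: ennpow_ennreal)

text \<open>
  The convention \<open>0 \<cdot> \<infinity> = 0\<close> is respected because \<open>ennpow\<close> keeps both \<open>0\<close> and \<open>\<infinity>\<close> fixed.
\<close>

lemma ennpow_mult:
  shows "ennpow (s * t) a = ennpow s a * ennpow t a"
proof (cases "s = top \<or> t = top")
  case True
  then show ?thesis
    by (elim disjE) (simp_all add: ennreal_mult_top ennreal_top_mult ennpow_eq_0_iff)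
next
  case False
  then obtain x y where "s = ennreal x" "0 \<le> x" "t = ennreal y" "0 \<le> y"
    by (metis ennreal_cases)
  then show ?thesis
    by (simp add: ennpow_ennreal powr_mult flip: ennreal_mult)
qed

lemma ennpow_1_left [simp]: "ennpow 1 a = 1"
  using ennpow_ennreal[of 1 a] by simp

lemma ennpow_prod:
  shows "ennpow (\<Prod>i\<in>I. t i) a = (\<Prod>i\<in>I. ennpow (t i) a)"
  by (induction I rule: infinite_finite_induct) (simp_all add: ennpow_mult)

lemma borel_measurable_ennpow [measurable]:
  "(\<lambda>t. ennpow t a) \<in> borel_measurable borel"
  unfolding ennpow_def by measurable

text \<open>
  An order argument, which treats finite and infinite limits alike: for \<open>z\<close> below the power of the limit,
  \<open>z\<^bsup>1 / a\<^esup>\<close> lies below the limit, hence eventually below the sequence.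
\<close>

lemma ennpow_le_liminf:
  fixes u :: "nat \<Rightarrow> ennreal"
  assumes "u \<longlonglongrightarrow> y" "a > 0"
  shows "ennpow y a \<le> liminf (\<lambda>n. ennpow (u n) a)"
  unfolding le_Liminf_iff
proof safe
  fix z assume "z < ennpow y a"
  then have "ennpow z (1 / a) < y"
    using assms ennpow_less_iff[of a "ennpow z (1 / a)" y] by (simp add: ennpow_ennpow)
  then have "\<forall>\<^sub>F n in sequentially. ennpow z (1 / a) < u n"
    using assms(1) by (rule order_tendstoD(1)[rotated])
  then show "\<forall>\<^sub>F n in sequentially. z < ennpow (u n) a"
    using assms ennpow_less_iff[of a "ennpow z (1 / a)"] by (simp add: ennpow_ennpow)
qed

section \<open>Strong and weak norms as integrals\<close>

lemma strong_norm_le_iff: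
  assumes "q > 0"
  shows "strong_norm M q g \<le> B \<longleftrightarrow> (\<integral>\<^sup>+x. ennpow (g x) q \<partial>M) \<le> ennpow B q"
  using assms by (simp add: strong_norm_def ennpow_inverse_le_iff)

text \<open>
  The half-line is taken open, in contrast to the set in the weak norm, to make this function
  of \<open>y\<close> lower semicontinuous.
\<close>

definition weak_gauge :: "real \<Rightarrow> real \<Rightarrow> ennreal \<Rightarrow> ennreal" where
  "weak_gauge q t y = ennpow (ennreal t) q * indicator {ennreal t<..} y"

text \<open>
  A closed superlevel set \<open>{g \<ge> t}\<close> is contained in the open ones \<open>{g > s}\<close> with \<open>s < t\<close>, so letting \<open>s\<close>
  increase to \<open>t\<close> shows that both kinds of superlevel sets define the same weak norm.
\<close>

lemma weak_norm_le_iff: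
  assumes q: "q > 0" and g: "g \<in> borel_measurable M"
  shows "weak_norm M q g \<le> B \<longleftrightarrow> (\<forall>t>0. (\<integral>\<^sup>+x. weak_gauge q t (g x) \<partial>M) \<le> ennpow B q)"
proof -
  let ?\<mu> = "\<lambda>t. emeasure M {x \<in> space M. ennreal t \<le> g x}"
  let ?\<nu> = "\<lambda>t. emeasure M {x \<in> space M. ennreal t < g x}"
  have int: "(\<integral>\<^sup>+x. weak_gauge q t (g x) \<partial>M) = ennpow (ennreal t) q * ?\<nu> t" for t
  proof -
    have "(\<integral>\<^sup>+x. weak_gauge q t (g x) \<partial>M) =
        (\<integral>\<^sup>+x. ennpow (ennreal t) q * indicator {x \<in> space M. ennreal t < g x} x \<partial>M)"
      by (intro nn_integral_cong) (auto simp: weak_gauge_def indicator_def)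
    then show ?thesis using g by (simp add: nn_integral_cmult_indicator)
  qed
  have "weak_norm M q g \<le> B \<longleftrightarrow> (\<forall>t>0. ennpow (ennreal t) q * ?\<mu> t \<le> ennpow B q)"
  proof -
    have "ennreal t * ennpow (?\<mu> t) (1 / q) \<le> B \<longleftrightarrow> ennpow (ennreal t) q * ?\<mu> t \<le> ennpow B q" for t
      using q ennpow_le_iff[OF q, of "ennreal t * ennpow (?\<mu> t) (1 / q)" B]
      by (simp add: ennpow_mult ennpow_ennpow)
    then show ?thesis by (auto simp: weak_norm_def SUP_le_iff)
  qed
  also have "\<dots> \<longleftrightarrow> (\<forall>t>0. ennpow (ennreal t) q * ?\<nu> t \<le> ennpow B q)"
  proof safe
    fix t :: real
    assume le: "\<forall>t>0. ennpow (ennreal t) q * ?\<mu> t \<le> ennpow B q" and "t > 0"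
    have "?\<nu> t \<le> ?\<mu> t"
      using g by (intro emeasure_mono) (auto intro: less_imp_le)
    then show "ennpow (ennreal t) q * ?\<nu> t \<le> ennpow B q"
      using le \<open>t > 0\<close> by (meson mult_left_mono order_trans zero_le)
  next
    fix t :: real
    assume le: "\<forall>t>0. ennpow (ennreal t) q * ?\<nu> t \<le> ennpow B q" and "t > 0"
    \<comment> \<open>A sequence strictly below \<open>t\<close> with limit \<open>t\<close>.\<close>
    define s where "s n = t * (real (Suc n) / real (Suc (Suc n)))" for n
    have s: "0 < s n" "s n < t" for n
      using \<open>t > 0\<close> by (auto simp: s_def field_simps add_pos_nonneg)
    have "s \<longlonglongrightarrow> t"
      using tendsto_mult[OF tendsto_const LIMSEQ_Suc[OF LIMSEQ_n_over_Suc_n], of t]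
      unfolding s_def by (simp only: mult_1_right)
    have "ennpow (ennreal (s n)) q * ?\<mu> t \<le> ennpow B q" for n
    proof -
      have "?\<mu> t \<le> ?\<nu> (s n)"
        using g less_le_trans[OF ennreal_lessI[OF \<open>t > 0\<close> s(2)[of n]]]
        by (intro emeasure_mono) auto
      then show ?thesis
        using le s by (meson mult_left_mono order_trans zero_le)
    qed
    moreover have "(\<lambda>n. ennpow (ennreal (s n)) q * ?\<mu> t) \<longlonglongrightarrow> ennpow (ennreal t) q * ?\<mu> t"
    proof -
      have "(\<lambda>n. ennreal (s n powr q)) \<longlonglongrightarrow> ennreal (t powr q)"
        using \<open>s \<longlonglongrightarrow> t\<close> \<open>t > 0\<close> by (intro tendsto_ennrealI tendsto_powr) auto
      then have "(\<lambda>n. ennpow (ennreal (s n)) q) \<longlonglongrightarrow> ennpow (ennreal t) q"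
        using s \<open>t > 0\<close> by (simp add: ennpow_ennreal less_imp_le)
      then show ?thesis
        using \<open>t > 0\<close> by (intro tendsto_mult_ennreal tendsto_const) (auto simp: ennpow_ennreal)
    qed
    ultimately show "ennpow (ennreal t) q * ?\<mu> t \<le> ennpow B q"
      by (intro LIMSEQ_le_const2) auto
  qed
  finally show ?thesis by (simp add: int)
qed

lemma weak_gauge_le_liminf:
  fixes u :: "nat \<Rightarrow> ennreal"
  assumes "u \<longlonglongrightarrow> y"
  shows "weak_gauge q t y \<le> liminf (\<lambda>n. weak_gauge q t (u n))"
proof (cases "ennreal t < y")
  case True
  then have "\<forall>\<^sub>F n in sequentially. ennreal t < u n"
    using assms order_tendstoD(1) by blast
  then show ?thesis
    using True by (intro Liminf_bounded) (auto simp: weak_gauge_def elim: eventually_mono)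
qed (simp add: weak_gauge_def)

lemma ennpow_Lp_norm:
  "ennpow (Lp_norm M q f) r = ennpow (\<integral>\<^sup>+x. ennreal (\<bar>f x\<bar> powr q) \<partial>M) (r / q)"
  by (simp add: Lp_norm_def strong_norm_def ennpow_ennpow ennpow_ennreal)

section \<open>Hoelder's inequality for several factors\<close>

text \<open>
  Concavity of the logarithm, after the case of a vanishing factor is set aside.
\<close>

lemma weighted_arith_geom_mean:
  fixes w x :: "'i \<Rightarrow> real"
  assumes "finite I" and w: "\<And>i. i \<in> I \<Longrightarrow> w i > 0" and "sum w I = 1"
    and x: "\<And>i. i \<in> I \<Longrightarrow> x i \<ge> 0"
  shows "(\<Prod>i\<in>I. x i powr w i) \<le> (\<Sum>i\<in>I. w i * x i)"
proof (cases "\<exists>i\<in>I. x i = 0")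
  case True
  then have "(\<Prod>i\<in>I. x i powr w i) = 0"
    using \<open>finite I\<close> by auto
  then show ?thesis
    using w x by (simp add: sum_nonneg less_imp_le)
next
  case False
  then have pos: "x i > 0" if "i \<in> I" for i
    using x[OF that] that by force
  have "I \<noteq> {}" using assms(3) by auto
  have sum_pos: "(\<Sum>i\<in>I. w i * x i) > 0"
    using \<open>finite I\<close> \<open>I \<noteq> {}\<close> w pos by (intro sum_pos) auto
  have "(\<Sum>i\<in>I. w i * ln (x i)) \<le> ln (\<Sum>i\<in>I. w i *\<^sub>R x i)"
    by (rule concave_on_sum[OF \<open>finite I\<close> \<open>I \<noteq> {}\<close> ln_concave])
       (use assms(3) w pos in \<open>auto intro: less_imp_le\<close>)
  then have "exp (\<Sum>i\<in>I. w i * ln (x i)) \<le> exp (ln (\<Sum>i\<in>I. w i *\<^sub>R x i))"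
    by (simp only: exp_le_cancel_iff)
  also have "\<dots> = (\<Sum>i\<in>I. w i * x i)"
    using sum_pos by simp
  also have "exp (\<Sum>i\<in>I. w i * ln (x i)) = (\<Prod>i\<in>I. x i powr w i)"
    unfolding exp_sum[OF \<open>finite I\<close>] using pos
    by (intro prod.cong) (auto simp: powr_def less_imp_neq[THEN not_sym])
  finally show ?thesis .
qed

text \<open>
  Hoelder's inequality. Normalising each function by its integral reduces it to the pointwise
  inequality between weighted arithmetic and geometric means, integrated.
\<close>

lemma nn_integral_prod_powr_le:
  fixes h :: "'i \<Rightarrow> 'a \<Rightarrow> real" and w :: "'i \<Rightarrow> real"
  assumes "finite I" and w: "\<And>i. i \<in> I \<Longrightarrow> w i > 0" and sum: "sum w I = 1"
    and h [measurable]: "\<And>i. i \<in> I \<Longrightarrow> h i \<in> borel_measurable M"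
    and nonneg: "\<And>i x. i \<in> I \<Longrightarrow> h i x \<ge> 0"
    and int: "\<And>i. i \<in> I \<Longrightarrow> (\<integral>\<^sup>+x. ennreal (h i x) \<partial>M) = ennreal (A i)"
    and A: "\<And>i. i \<in> I \<Longrightarrow> A i \<ge> 0"
  shows "(\<integral>\<^sup>+x. ennreal (\<Prod>i\<in>I. h i x powr w i) \<partial>M) \<le> ennreal (\<Prod>i\<in>I. A i powr w i)"
proof (cases "\<exists>i\<in>I. A i = 0")
  case True
  then obtain i where i: "i \<in> I" "A i = 0" by blast
  then have "AE x in M. ennreal (h i x) = 0"
    using int[OF i(1)] by (simp add: nn_integral_0_iff_AE)
  then have "AE x in M. ennreal (\<Prod>i\<in>I. h i x powr w i) = 0"
  proof eventually_elim
    case (elim x)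
    then have "h i x = 0" using nonneg[OF i(1), of x] by simp
    then have "(\<Prod>i\<in>I. h i x powr w i) = 0" using i \<open>finite I\<close> by auto
    then show ?case by simp
  qed
  then have "(\<integral>\<^sup>+x. ennreal (\<Prod>i\<in>I. h i x powr w i) \<partial>M) = 0"
    using nn_integral_cong_AE[of _ "\<lambda>_. 0" M] by (simp only: nn_integral_const mult_zero_left)
  then show ?thesis by simp
next
  case False
  then have pos: "A i > 0" if "i \<in> I" for i using A[OF that] that by force
  let ?c = "\<Prod>i\<in>I. A i powr w i"
  have "(\<Prod>i\<in>I. h i x powr w i) \<le> ?c * (\<Sum>i\<in>I. w i * (h i x / A i))" for x
  proof -
    have "(\<Prod>i\<in>I. h i x powr w i) = ?c * (\<Prod>i\<in>I. (h i x / A i) powr w i)"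
      unfolding prod.distrib[symmetric] using pos nonneg
      by (intro prod.cong refl) (simp add: powr_divide less_imp_le order_less_imp_not_eq2)
    also have "\<dots> \<le> ?c * (\<Sum>i\<in>I. w i * (h i x / A i))"
      by (intro mult_left_mono weighted_arith_geom_mean prod_nonneg \<open>finite I\<close> w sum
          divide_nonneg_pos nonneg pos powr_ge_zero ballI)
    finally show ?thesis .
  qed
  then have "(\<integral>\<^sup>+x. ennreal (\<Prod>i\<in>I. h i x powr w i) \<partial>M)
      \<le> (\<integral>\<^sup>+x. ennreal (?c * (\<Sum>i\<in>I. w i * (h i x / A i))) \<partial>M)"
    by (intro nn_integral_mono ennreal_leI)
  also have "\<dots> = (\<integral>\<^sup>+x. ennreal ?c * (\<Sum>i\<in>I. ennreal (w i / A i) * ennreal (h i x)) \<partial>M)"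
  proof (rule nn_integral_cong)
    fix x
    have nonneg': "0 \<le> w i * (h i x / A i)" if "i \<in> I" for i
      using w[OF that] pos[OF that] nonneg[OF that, of x] by simp
    have "ennreal (\<Sum>i\<in>I. w i * (h i x / A i)) = (\<Sum>i\<in>I. ennreal (w i * (h i x / A i)))"
      using nonneg' by (rule sum_ennreal[symmetric])
    also have "\<dots> = (\<Sum>i\<in>I. ennreal (w i / A i) * ennreal (h i x))"
    proof (rule sum.cong[OF refl])
      fix i assume i: "i \<in> I"
      show "ennreal (w i * (h i x / A i)) = ennreal (w i / A i) * ennreal (h i x)"
        using w[OF i] pos[OF i] nonneg[OF i, of x] by (simp flip: ennreal_mult)
    qed
    finally show "ennreal (?c * (\<Sum>i\<in>I. w i * (h i x / A i))) =
        ennreal ?c * (\<Sum>i\<in>I. ennreal (w i / A i) * ennreal (h i x))"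
      using nonneg' by (simp add: ennreal_mult prod_nonneg sum_nonneg)
  qed
  also have "\<dots> = ennreal ?c * (\<Sum>i\<in>I. ennreal (w i / A i) * ennreal (A i))"
    by (simp add: nn_integral_cmult nn_integral_sum int cong: sum.cong)
  also have "(\<Sum>i\<in>I. ennreal (w i / A i) * ennreal (A i)) = (\<Sum>i\<in>I. ennreal (w i))"
  proof (intro sum.cong refl)
    fix i assume "i \<in> I"
    with w[OF this] pos[OF this] show "ennreal (w i / A i) * ennreal (A i) = ennreal (w i)"
      by (simp flip: ennreal_mult)
  qed
  also have "\<dots> = 1"
    using w sum by (simp add: sum_ennreal less_imp_le)
  finally show ?thesis by simp
qed

section \<open>Averaging over large boxes\<close>

definition lattice_box :: "nat \<Rightarrow> nat \<Rightarrow> (nat \<Rightarrow> int) set" where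
  "lattice_box d R = {1..d} \<rightarrow>\<^sub>E {- int R..int R}"

lemma finite_lattice_box [simp]: "finite (lattice_box d R)"
  by (auto simp: lattice_box_def intro: finite_PiE)

lemma card_lattice_box: "card (lattice_box d R) = (2 * R + 1) ^ d"
proof -
  have "nat (1 + 2 * int R) = 2 * R + 1" by (simp add: nat_eq_iff)
  then show ?thesis by (simp add: lattice_box_def card_PiE algebra_simps)
qed

text \<open>
  Enlarging a box by a fixed width multiplies its number of points by a factor that tends to \<open>1\<close>.
\<close>

lemma card_lattice_box_ratio_le:
  "real (card (lattice_box d (n + L))) \<le> (1 + 2 * real L * inverse (real (Suc n))) ^ d * real (card (lattice_box d n))"
proof -
  have "2 * (real n + real L) + 1 \<le> (1 + 2 * real L * inverse (real (Suc n))) * (2 * real n + 1)"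
    by (simp add: field_simps)
  then have "(2 * (real n + real L) + 1) ^ d \<le> ((1 + 2 * real L * inverse (real (Suc n))) * (2 * real n + 1)) ^ d"
    by (intro power_mono) auto
  then show ?thesis by (simp add: card_lattice_box power_mult_distrib add_ac)
qed

text \<open>
  Integrating the hypothesis multiplies the left side by the number of points of the box of radius \<open>R\<close>
  and, since the exponents sum to \<open>1\<close>, the right side by that of the box of radius \<open>R + L\<close>. Dividing
  and letting \<open>R\<close> tend to infinity removes both factors: the amenability of \<open>\<int>\<^sup>d\<close>.
\<close>

lemma nn_integral_le_of_box_sums_le:
  fixes h :: "'i \<Rightarrow> 'a \<Rightarrow> real" and w :: "'i \<Rightarrow> real"
  assumes inv: "\<And>i. i \<in> {1..d} \<Longrightarrow> invertible_mp_map M (T i)"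
    and "finite I" and w: "\<And>i. i \<in> I \<Longrightarrow> w i > 0" and sum: "sum w I = 1"
    and G [measurable]: "G \<in> borel_measurable M"
    and h [measurable]: "\<And>i. i \<in> I \<Longrightarrow> h i \<in> borel_measurable M"
    and nonneg: "\<And>i x. i \<in> I \<Longrightarrow> h i x \<ge> 0"
    and int: "\<And>i. i \<in> I \<Longrightarrow> (\<integral>\<^sup>+x. ennreal (h i x) \<partial>M) = ennreal (A i)"
    and A: "\<And>i. i \<in> I \<Longrightarrow> A i \<ge> 0"
    and "0 \<le> c"
    and le: "\<And>R x. x \<in> space M \<Longrightarrow>
      (\<Sum>l\<in>lattice_box d R. G (multi_iterate (space M) d T l x)) \<le>
      ennreal c * ennreal (\<Prod>i\<in>I. (\<Sum>l\<in>lattice_box d (R + L). h i (multi_iterate (space M) d T l x)) powr w i)"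
  shows "(\<integral>\<^sup>+x. G x \<partial>M) \<le> ennreal c * ennreal (\<Prod>i\<in>I. A i powr w i)"
proof -
  let ?\<tau> = "multi_iterate (space M) d T"
  let ?B = "\<lambda>R. real (card (lattice_box d R))"
  define a where "a = c * (\<Prod>i\<in>I. A i powr w i)"
  have "a \<ge> 0" using \<open>0 \<le> c\<close> by (simp add: a_def prod_nonneg)
  have mp: "measure_preserving_map M (?\<tau> l)" for l
    using inv by (rule measure_preserving_multi_iterate)
  then have [measurable]: "?\<tau> l \<in> measurable M M" for l
    by (simp add: measure_preserving_map_def)
  have B_pos: "?B R > 0" for R by (simp add: card_lattice_box)
  have box: "ennreal (?B R) * (\<integral>\<^sup>+x. G x \<partial>M) \<le> ennreal (?B (R + L) * a)" for R
  proof -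
    have "ennreal (?B R) * (\<integral>\<^sup>+x. G x \<partial>M) = (\<integral>\<^sup>+x. (\<Sum>l\<in>lattice_box d R. G (?\<tau> l x)) \<partial>M)"
      by (simp add: nn_integral_sum nn_integral_measure_preserving[OF mp] ennreal_of_nat_eq_real_of_nat)
    also have "\<dots> \<le> (\<integral>\<^sup>+x. ennreal c * ennreal (\<Prod>i\<in>I. (\<Sum>l\<in>lattice_box d (R + L). h i (?\<tau> l x)) powr w i) \<partial>M)"
      using le by (intro nn_integral_mono) auto
    also have "\<dots> = ennreal c * (\<integral>\<^sup>+x. ennreal (\<Prod>i\<in>I. (\<Sum>l\<in>lattice_box d (R + L). h i (?\<tau> l x)) powr w i) \<partial>M)"
      by (rule nn_integral_cmult) measurable
    also have "\<dots> \<le> ennreal c * ennreal (\<Prod>i\<in>I. (?B (R + L) * A i) powr w i)"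
    proof (intro mult_left_mono nn_integral_prod_powr_le \<open>finite I\<close> w sum)
      fix i assume i: "i \<in> I"
      have "(\<integral>\<^sup>+x. ennreal (\<Sum>l\<in>lattice_box d (R + L). h i (?\<tau> l x)) \<partial>M)
          = (\<Sum>l\<in>lattice_box d (R + L). \<integral>\<^sup>+x. ennreal (h i (?\<tau> l x)) \<partial>M)"
        using i nonneg by (subst nn_integral_sum[symmetric]) (auto simp: sum_ennreal)
      also have "\<dots> = (\<Sum>l\<in>lattice_box d (R + L). ennreal (A i))"
        using i int nn_integral_measure_preserving[OF mp, of "\<lambda>x. ennreal (h i x)"] by simp
      also have "\<dots> = ennreal (?B (R + L) * A i)"
        using A[OF i] by (simp add: ennreal_mult ennreal_of_nat_eq_real_of_nat)
      finally show "(\<integral>\<^sup>+x. ennreal (\<Sum>l\<in>lattice_box d (R + L). h i (?\<tau> l x)) \<partial>M) = ennreal (?B (R + L) * A i)" .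
    qed (use nonneg A in \<open>auto intro!: sum_nonneg\<close>)
    also have "(\<Prod>i\<in>I. (?B (R + L) * A i) powr w i) = ?B (R + L) * (\<Prod>i\<in>I. A i powr w i)"
    proof -
      have "(\<Prod>i\<in>I. (?B (R + L) * A i) powr w i) = (\<Prod>i\<in>I. ?B (R + L) powr w i * A i powr w i)"
        by (simp only: powr_mult)
      also have "\<dots> = ?B (R + L) powr sum w I * (\<Prod>i\<in>I. A i powr w i)"
        using powr_sum[of "?B (R + L)" w I] B_pos[of "R + L"] by (simp only: prod.distrib)
      finally show ?thesis using sum B_pos[of "R + L"] by simp
    qed
    also have "ennreal c * ennreal (?B (R + L) * (\<Prod>i\<in>I. A i powr w i)) = ennreal (?B (R + L) * a)"
      using \<open>0 \<le> c\<close> by (simp add: a_def prod_nonneg mult_ac flip: ennreal_mult)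
    finally show ?thesis .
  qed
  \<comment> \<open>The factor from comparing the numbers of points of the two boxes, of limit \<open>1\<close>.\<close>
  define r where "r n = (1 + 2 * real L * inverse (real (Suc n))) ^ d" for n
  have "(\<integral>\<^sup>+x. G x \<partial>M) \<le> ennreal (r n * a)" for n
  proof -
    have nonzero: "ennreal (?B n) \<noteq> 0"
      using B_pos[of n] by (simp only: ennreal_eq_0_iff not_le)
    have "ennreal (?B n) * (\<integral>\<^sup>+x. G x \<partial>M) \<le> ennreal (?B (n + L) * a)" by (rule box)
    also have "\<dots> \<le> ennreal (?B n * (r n * a))"
      using mult_right_mono[OF card_lattice_box_ratio_le[of d n L] \<open>a \<ge> 0\<close>]
      by (intro ennreal_leI) (simp add: r_def mult_ac)
    also have "\<dots> = ennreal (?B n) * ennreal (r n * a)"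
      using \<open>a \<ge> 0\<close> by (intro ennreal_mult) (auto simp: r_def)
    finally show ?thesis
      by (simp only: ennreal_mult_le_mult_iff[OF nonzero ennreal_neq_top])
  qed
  moreover have "(\<lambda>n. ennreal (r n * a)) \<longlonglongrightarrow> ennreal ((1 + 2 * real L * 0) ^ d * a)"
    unfolding r_def by (intro tendsto_intros LIMSEQ_inverse_real_of_nat)
  ultimately have "(\<integral>\<^sup>+x. G x \<partial>M) \<le> ennreal ((1 + 2 * real L * 0) ^ d * a)"
    by (intro LIMSEQ_le_const) auto
  then show ?thesis
    using \<open>0 \<le> c\<close> by (simp add: a_def prod_nonneg flip: ennreal_mult)
qed

section \<open>Truncated orbits as functions on the lattice\<close>

text \<open>
  The values of \<open>f\<close> along the orbit of \<open>x\<close>, as a function on the lattice, cut off outside a box so that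
  it lies in every \<open>L\<^sup>p\<close> space.
\<close>

definition orbit_truncation ::
    "'a measure \<Rightarrow> nat \<Rightarrow> (nat \<Rightarrow> 'a \<Rightarrow> 'a) \<Rightarrow> nat \<Rightarrow> ('a \<Rightarrow> real) \<Rightarrow> 'a \<Rightarrow> (nat \<Rightarrow> int) \<Rightarrow> real" where
  "orbit_truncation M d T R f x l =
     (if l \<in> lattice_box d R then f (multi_iterate (space M) d T l x) else 0)"

text \<open>
  Started in the box of radius \<open>R\<close>, shifts by at most \<open>L\<close> in each coordinate stay where the truncation
  has no effect.
\<close>

lemma poly_average_orbit_truncation:
  assumes sys: "mp_system M d T" and x: "x \<in> space M" and l: "l \<in> lattice_box d R" and "N \<le> K"
    and L: "\<And>i j n. i \<in> {1..d} \<Longrightarrow> j \<in> {1..m} \<Longrightarrow> n \<in> {1..k} \<rightarrow>\<^sub>E {1..K} \<Longrightarrow> \<bar>mpoly_int (P i j) n\<bar> \<le> int L"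
  shows "poly_average (canonical_measure d) d canonical_shift m k P
           (\<lambda>j. orbit_truncation M d T (R + L) (f j) x) N l =
         poly_average M d T m k P f N (multi_iterate (space M) d T l x)"
proof -
  let ?\<tau> = "multi_iterate (space M) d T"
  have eq: "orbit_truncation M d T (R + L) (f j) x
        (multi_iterate (space (canonical_measure d)) d canonical_shift (\<lambda>i. mpoly_int (P i j) n) l) =
      f j (?\<tau> (\<lambda>i. mpoly_int (P i j) n) (?\<tau> l x))"
    if n: "n \<in> {1..k} \<rightarrow>\<^sub>E {1..N}" and j: "j \<in> {1..m}" for n j
  proof -
    let ?e = "\<lambda>i. mpoly_int (P i j) n"
    have n': "n \<in> {1..k} \<rightarrow>\<^sub>E {1..K}"
      using n \<open>N \<le> K\<close> PiE_mono[of "{1..k}" "\<lambda>_. {1..N}" "\<lambda>_. {1..K}"] by auto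
    have "l \<in> {1..d} \<rightarrow>\<^sub>E UNIV" using l by (auto simp: lattice_box_def PiE_iff)
    then have shift: "multi_iterate (space (canonical_measure d)) d canonical_shift ?e l = (\<lambda>i\<in>{1..d}. l i + ?e i)"
      by (simp only: canonical_measure_def space_count_space multi_iterate_canonical_shift)
    moreover have "(\<lambda>i\<in>{1..d}. l i + ?e i) \<in> lattice_box d (R + L)"
    proof -
      have "l i + ?e i \<in> {- int (R + L)..int (R + L)}" if "i \<in> {1..d}" for i
        using L[OF that j n'] PiE_mem[OF l[unfolded lattice_box_def] that] by auto
      then show ?thesis unfolding lattice_box_def by auto
    qed
    moreover have "?\<tau> (\<lambda>i\<in>{1..d}. l i + ?e i) x = ?\<tau> ?e (?\<tau> l x)"
      unfolding multi_iterate_restrict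
      using multi_iterate_add[OF sys x, of ?e l] by (simp add: add.commute)
    ultimately show ?thesis by (simp add: orbit_truncation_def)
  qed
  show ?thesis
    unfolding poly_average_def using eq by (intro arg_cong2[of _ _ _ _ "(*)"] refl sum.cong prod.cong)
qed

lemma bounded_mpoly_int:
  fixes P :: "nat \<Rightarrow> nat \<Rightarrow> real_mpoly"
  shows "\<exists>L. \<forall>i\<in>{1..d}. \<forall>j\<in>{1..m}. \<forall>n\<in>{1..k} \<rightarrow>\<^sub>E {1..K}. \<bar>mpoly_int (P i j) n\<bar> \<le> int L"
proof -
  let ?S = "(\<lambda>(i, j, n). nat \<bar>mpoly_int (P i j) n\<bar>) ` ({1..d} \<times> {1..m} \<times> ({1..k} \<rightarrow>\<^sub>E {1..K}))"
  have "finite ?S" by (intro finite_imageI finite_cartesian_product finite_PiE) auto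
  then obtain L where L: "\<forall>s\<in>?S. s \<le> L"
    unfolding finite_nat_set_iff_bounded_le by blast
  have "\<bar>mpoly_int (P i j) n\<bar> \<le> int L"
    if "i \<in> {1..d}" "j \<in> {1..m}" "n \<in> {1..k} \<rightarrow>\<^sub>E {1..K}" for i j n
  proof -
    have "nat \<bar>mpoly_int (P i j) n\<bar> \<in> ?S" using that by force
    then show ?thesis using L by (metis nat_le_iff)
  qed
  then show ?thesis by blast
qed

lemma orbit_truncation_integral:
  "(\<integral>\<^sup>+l. ennreal (\<bar>orbit_truncation M d T R f x l\<bar> powr q) \<partial>canonical_measure d) =
   ennreal (\<Sum>l\<in>lattice_box d R. \<bar>f (multi_iterate (space M) d T l x)\<bar> powr q)"
proof -
  have "(\<integral>\<^sup>+l. ennreal (\<bar>orbit_truncation M d T R f x l\<bar> powr q) \<partial>canonical_measure d) =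
      (\<Sum>l\<in>lattice_box d R. ennreal (\<bar>orbit_truncation M d T R f x l\<bar> powr q))"
    unfolding canonical_measure_def
    by (rule nn_integral_count_space'[OF finite_lattice_box]) (auto simp: orbit_truncation_def lattice_box_def)
  also have "\<dots> = ennreal (\<Sum>l\<in>lattice_box d R. \<bar>f (multi_iterate (space M) d T l x)\<bar> powr q)"
    by (simp add: orbit_truncation_def)
  finally show ?thesis .
qed

lemma orbit_truncation_Lp_space:
  "orbit_truncation M d T R f x \<in> Lp_space (canonical_measure d) q"
proof -
  have "ennpow (Lp_norm (canonical_measure d) q (orbit_truncation M d T R f x)) 1 < top"
    unfolding ennpow_Lp_norm orbit_truncation_integral by (simp only: ennpow_less_top_iff ennreal_less_top)
  then show ?thesis by (simp add: Lp_space_def canonical_measure_def)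
qed

section \<open>Limits of functionals of finitely many averages\<close>

lemma borel_measurable_poly_average:
  assumes "\<And>i. i \<in> {1..d} \<Longrightarrow> invertible_mp_map M (T i)"
    and f: "\<And>j. j \<in> {1..m} \<Longrightarrow> f j \<in> borel_measurable M"
  shows "poly_average M d T m k P f N \<in> borel_measurable M"
proof -
  have [measurable]: "multi_iterate (space M) d T e \<in> measurable M M" for e
    using measure_preserving_multi_iterate[where M = M and T = T and d = d, OF assms(1)]
    by (simp add: measure_preserving_map_def)
  have "(\<lambda>x. f j (multi_iterate (space M) d T e x)) \<in> borel_measurable M" if "j \<in> {1..m}" for j e
    using f[OF that] by measurable
  then show ?thesis
    unfolding poly_average_def[abs_def]
    by (intro borel_measurable_times borel_measurable_sum borel_measurable_prod borel_measurable_const)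
qed

text \<open>
  The finite approximations as functionals \<open>V K\<close> on whole sequences that depend on the first \<open>K + 1\<close>
  terms only. The shift of the index by one makes all \<open>V K\<close>, including \<open>V 0\<close>, approximations.
\<close>

lemma finitary_limitE:
  fixes M :: "'a measure"
  assumes "finitary_limit \<O>"
  obtains V :: "nat \<Rightarrow> (nat \<Rightarrow> real) \<Rightarrow> ennreal" where
    "\<And>K a. V K a \<le> \<O> a" "\<And>a. (\<lambda>K. V K a) \<longlonglongrightarrow> \<O> a"
    "\<And>K a b. (\<And>N. N \<in> {1..Suc K} \<Longrightarrow> a N = b N) \<Longrightarrow> V K a = V K b"
    "\<And>K a. (\<And>N. a N \<in> borel_measurable M) \<Longrightarrow> (\<lambda>x. V K (\<lambda>N. a N x)) \<in> borel_measurable M"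
proof -
  obtain \<O>' :: "nat \<Rightarrow> (nat \<Rightarrow> real) \<Rightarrow> real" where
    meas: "\<And>K. K \<ge> 1 \<Longrightarrow> \<O>' K \<in> borel_measurable (Pi\<^sub>M {1..K} (\<lambda>_. borel))" and
    le: "\<And>a K. K \<ge> 1 \<Longrightarrow> ennreal (\<O>' K (restrict a {1..K})) \<le> \<O> a" and
    lim: "\<And>a. (\<lambda>K. ennreal (\<O>' K (restrict a {1..K}))) \<longlonglongrightarrow> \<O> a"
    using assms unfolding finitary_limit_def by blast
  let ?V = "\<lambda>K a. ennreal (\<O>' (Suc K) (restrict a {1..Suc K}))"
  show thesis
  proof (rule that[of ?V])
    show "?V K a \<le> \<O> a" for K a by (rule le) simp
    show "(\<lambda>K. ?V K a) \<longlonglongrightarrow> \<O> a" for a using lim by (rule LIMSEQ_Suc)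
    show "?V K a = ?V K b" if "\<And>N. N \<in> {1..Suc K} \<Longrightarrow> a N = b N" for K a b
      using restrict_ext[of "{1..Suc K}" a b] that by simp
    show "(\<lambda>x. ?V K (\<lambda>N. a N x)) \<in> borel_measurable M" if [measurable]: "\<And>N. a N \<in> borel_measurable M" for K a
    proof -
      have [measurable]: "\<O>' (Suc K) \<in> borel_measurable (Pi\<^sub>M {1..Suc K} (\<lambda>_. borel))" by (rule meas) simp
      show ?thesis by measurable
    qed
  qed
qed

lemma borel_measurable_finitary_limit:
  assumes "finitary_limit \<O>" and a: "\<And>N. a N \<in> borel_measurable M"
  shows "(\<lambda>x. \<O> (\<lambda>N. a N x)) \<in> borel_measurable M"
proof (rule finitary_limitE[OF assms(1), where M = M])
  fix V :: "nat \<Rightarrow> (nat \<Rightarrow> real) \<Rightarrow> ennreal"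
  assume "\<And>b. (\<lambda>K. V K b) \<longlonglongrightarrow> \<O> b"
    and V: "\<And>K a. (\<And>N. a N \<in> borel_measurable M) \<Longrightarrow> (\<lambda>x. V K (\<lambda>N. a N x)) \<in> borel_measurable M"
  then show ?thesis
    by (intro borel_measurable_LIMSEQ_order[OF _ V[OF a]])
qed

section \<open>Transference\<close>

text \<open>
  The transference principle for a nondecreasing lower semicontinuous function \<open>\<Phi>\<close>. Monotonicity lets
  \<open>\<O>\<close> on the lattice dominate its finite approximation \<open>V K\<close>, which sees bounded shifts only and so can
  be computed from truncated orbits; lower semicontinuity and Fatou's lemma recover \<open>\<O>\<close> on the system.
\<close>

lemma transference:
  fixes \<Phi> :: "ennreal \<Rightarrow> ennreal" and p :: "nat \<Rightarrow> real"
  assumes sys: "mp_system M d T" and \<O>: "finitary_limit \<O>"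
    and p: "\<And>j. j \<in> {0..m} \<Longrightarrow> p j > 0" and p_sum: "(\<Sum>j\<in>{1..m}. 1 / p j) = 1 / p 0"
    and \<Phi> [measurable]: "\<Phi> \<in> borel_measurable borel" and "mono \<Phi>"
    and lsc: "\<And>u y. u \<longlonglongrightarrow> y \<Longrightarrow> \<Phi> y \<le> liminf (\<lambda>n. \<Phi> (u n))"
    and "0 \<le> c"
    and canonical: "\<And>f. (\<And>j. j \<in> {1..m} \<Longrightarrow> f j \<in> Lp_space (canonical_measure d) (p j)) \<Longrightarrow>
      (\<integral>\<^sup>+l. \<Phi> (\<O> (\<lambda>N. poly_average (canonical_measure d) d canonical_shift m k P f N l)) \<partial>canonical_measure d)
        \<le> ennreal c * (\<Prod>j\<in>{1..m}. ennpow (Lp_norm (canonical_measure d) (p j) (f j)) (p 0))"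
    and f: "\<And>j. j \<in> {1..m} \<Longrightarrow> f j \<in> Lp_space M (p j)"
  shows "(\<integral>\<^sup>+x. \<Phi> (\<O> (\<lambda>N. poly_average M d T m k P f N x)) \<partial>M)
    \<le> ennreal c * (\<Prod>j\<in>{1..m}. ennpow (Lp_norm M (p j) (f j)) (p 0))"
proof -
  let ?\<tau> = "multi_iterate (space M) d T"
  let ?a = "\<lambda>x N. poly_average M d T m k P f N x"
  define w where "w j = p 0 / p j" for j
  have w: "w j > 0" if "j \<in> {1..m}" for j using p[of 0] p[of j] that by (simp add: w_def)
  have "sum w {1..m} = p 0 * (\<Sum>j\<in>{1..m}. 1 / p j)"
    unfolding w_def sum_distrib_left by simp
  then have w_sum: "sum w {1..m} = 1" using p_sum p[of 0] by simp
  have inv: "invertible_mp_map M (T i)" if "i \<in> {1..d}" for i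
    using sys that by (auto simp: mp_system_def)
  have f_meas [measurable]: "f j \<in> borel_measurable M" if "j \<in> {1..m}" for j
    using f[OF that] by (simp add: Lp_space_def)
  define h where "h j x = \<bar>f j x\<bar> powr p j" for j x
  define A where "A j = enn2real (\<integral>\<^sup>+x. ennreal (h j x) \<partial>M)" for j
  have A: "(\<integral>\<^sup>+x. ennreal (h j x) \<partial>M) = ennreal (A j)" if "j \<in> {1..m}" for j
  proof -
    have "ennpow (Lp_norm M (p j) (f j)) 1 < top"
      using f[OF that] by (simp add: Lp_space_def)
    then show ?thesis unfolding ennpow_Lp_norm by (simp add: A_def h_def)
  qed
  have A_nonneg: "A j \<ge> 0" for j by (simp add: A_def)
  obtain V where V_le: "\<And>K a. V K a \<le> \<O> a" and V_lim: "\<And>a. (\<lambda>K. V K a) \<longlonglongrightarrow> \<O> a"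
    and V_cong: "\<And>K a b. (\<And>N. N \<in> {1..Suc K} \<Longrightarrow> a N = b N) \<Longrightarrow> V K a = V K b"
    and V_meas: "\<And>K a. (\<And>N. a N \<in> borel_measurable M) \<Longrightarrow> (\<lambda>x. V K (\<lambda>N. a N x)) \<in> borel_measurable M"
    by (rule finitary_limitE[OF \<O>, where M = M]) blast
  have V_avg [measurable]: "(\<lambda>x. V K (?a x)) \<in> borel_measurable M" for K
    by (intro V_meas borel_measurable_poly_average inv f_meas)
  \<comment> \<open>Apply the hypothesis on the lattice to truncated orbits and average over the starting point.\<close>
  have finitary: "(\<integral>\<^sup>+x. \<Phi> (V K (?a x)) \<partial>M) \<le> ennreal c * ennreal (\<Prod>j\<in>{1..m}. A j powr w j)" for K
  proof -
    obtain L where L: "\<And>i j n. i \<in> {1..d} \<Longrightarrow> j \<in> {1..m} \<Longrightarrow> n \<in> {1..k} \<rightarrow>\<^sub>E {1..Suc K} \<Longrightarrow>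
        \<bar>mpoly_int (P i j) n\<bar> \<le> int L"
      using bounded_mpoly_int[of d m k "Suc K" P] by blast
    show ?thesis
    proof (rule nn_integral_le_of_box_sums_le[OF inv _ w w_sum _ _ _ A A_nonneg \<open>0 \<le> c\<close>])
      fix R x assume x: "x \<in> space M"
      define F where "F j = orbit_truncation M d T (R + L) (f j) x" for j
      let ?b = "\<lambda>l N. poly_average (canonical_measure d) d canonical_shift m k P F N l"
      have "(\<Sum>l\<in>lattice_box d R. \<Phi> (V K (?a (?\<tau> l x)))) \<le> (\<Sum>l\<in>lattice_box d R. \<Phi> (\<O> (?b l)))"
      proof (rule sum_mono)
        fix l assume l: "l \<in> lattice_box d R"
        have "V K (?a (?\<tau> l x)) = V K (?b l)"
          unfolding F_def
          by (intro V_cong poly_average_orbit_truncation[OF sys x l, symmetric, where K = "Suc K"] L) auto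
        then show "\<Phi> (V K (?a (?\<tau> l x))) \<le> \<Phi> (\<O> (?b l))"
          using V_le[of K "?b l"] \<open>mono \<Phi>\<close> by (simp add: monoD)
      qed
      also have "\<dots> = (\<integral>\<^sup>+l. \<Phi> (\<O> (?b l)) * indicator (lattice_box d R) l \<partial>canonical_measure d)"
        unfolding canonical_measure_def
        by (subst nn_integral_count_space'[OF finite_lattice_box[of d R]]) (auto simp: lattice_box_def)
      also have "\<dots> \<le> (\<integral>\<^sup>+l. \<Phi> (\<O> (?b l)) \<partial>canonical_measure d)"
        by (intro nn_integral_mono) (auto simp: indicator_def)
      also have "\<dots> \<le> ennreal c * (\<Prod>j\<in>{1..m}. ennpow (Lp_norm (canonical_measure d) (p j) (F j)) (p 0))"
        by (rule canonical) (simp add: F_def orbit_truncation_Lp_space)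
      also have "(\<Prod>j\<in>{1..m}. ennpow (Lp_norm (canonical_measure d) (p j) (F j)) (p 0)) =
          ennreal (\<Prod>j\<in>{1..m}. (\<Sum>l\<in>lattice_box d (R + L). h j (?\<tau> l x)) powr w j)"
        by (simp add: ennpow_Lp_norm F_def orbit_truncation_integral ennpow_ennreal sum_nonneg
            prod_ennreal h_def w_def)
      finally show "(\<Sum>l\<in>lattice_box d R. \<Phi> (V K (?a (?\<tau> l x)))) \<le>
          ennreal c * ennreal (\<Prod>j\<in>{1..m}. (\<Sum>l\<in>lattice_box d (R + L). h j (?\<tau> l x)) powr w j)" .
    qed (auto simp: h_def)
  qed
  have "(\<integral>\<^sup>+x. \<Phi> (\<O> (?a x)) \<partial>M) \<le> (\<integral>\<^sup>+x. liminf (\<lambda>K. \<Phi> (V K (?a x))) \<partial>M)"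
    by (intro nn_integral_mono lsc V_lim)
  also have "\<dots> \<le> liminf (\<lambda>K. \<integral>\<^sup>+x. \<Phi> (V K (?a x)) \<partial>M)"
    by (rule nn_integral_liminf) measurable
  also have "\<dots> \<le> ennreal c * ennreal (\<Prod>j\<in>{1..m}. A j powr w j)"
    using finitary by (intro Liminf_le) auto
  also have "ennreal (\<Prod>j\<in>{1..m}. A j powr w j) = (\<Prod>j\<in>{1..m}. ennpow (Lp_norm M (p j) (f j)) (p 0))"
    using A unfolding ennpow_Lp_norm h_def w_def
    by (simp add: prod_ennreal[symmetric] ennpow_ennreal A_nonneg)
  finally show ?thesis .
qed

text \<open>
  Only finite constants have to be transferred, since an infinite one bounds every infimum. The
  restriction matters: a product of norms may vanish, and then the factor \<open>\<infinity>\<close> does not make an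
  inequality trivial.
\<close>

lemma optimal_constant_mono_of_transfer:
  fixes nrm1 :: "'a measure \<Rightarrow> real \<Rightarrow> ('a \<Rightarrow> ennreal) \<Rightarrow> ennreal"
    and nrm2 :: "'b measure \<Rightarrow> real \<Rightarrow> ('b \<Rightarrow> ennreal) \<Rightarrow> ennreal"
  assumes "\<And>c f. \<lbrakk>0 \<le> c; \<And>f. (\<And>j. j \<in> {1..m} \<Longrightarrow> f j \<in> Lp_space M2 (p j)) \<Longrightarrow>
        nrm2 M2 (p 0) (\<lambda>x. \<O> (\<lambda>N. poly_average M2 d T2 m k P f N x))
          \<le> ennreal c * (\<Prod>j\<in>{1..m}. Lp_norm M2 (p j) (f j));
      \<And>j. j \<in> {1..m} \<Longrightarrow> f j \<in> Lp_space M1 (p j)\<rbrakk> \<Longrightarrow>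
        nrm1 M1 (p 0) (\<lambda>x. \<O> (\<lambda>N. poly_average M1 d T1 m k P f N x))
          \<le> ennreal c * (\<Prod>j\<in>{1..m}. Lp_norm M1 (p j) (f j))"
  shows "optimal_constant nrm1 \<O> M1 d T1 m k P p \<le> optimal_constant nrm2 \<O> M2 d T2 m k P p"
  unfolding optimal_constant_def
proof (rule Inf_greatest)
  fix C assume C: "C \<in> {C. \<forall>f. (\<forall>j\<in>{1..m}. f j \<in> Lp_space M2 (p j)) \<longrightarrow>
    nrm2 M2 (p 0) (\<lambda>x. \<O> (\<lambda>N. poly_average M2 d T2 m k P f N x))
      \<le> C * (\<Prod>j\<in>{1..m}. Lp_norm M2 (p j) (f j))}"
  show "Inf {C. \<forall>f. (\<forall>j\<in>{1..m}. f j \<in> Lp_space M1 (p j)) \<longrightarrow>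
    nrm1 M1 (p 0) (\<lambda>x. \<O> (\<lambda>N. poly_average M1 d T1 m k P f N x))
      \<le> C * (\<Prod>j\<in>{1..m}. Lp_norm M1 (p j) (f j))} \<le> C"
  proof (cases C)
    case (real c)
    show ?thesis
      unfolding real(2) using C unfolding real(2)
      by (intro Inf_lower CollectI allI impI assms[OF real(1)]) blast+
  qed simp
qed

theorem theorem1p6:
  fixes d m k :: nat
    and M :: "'a measure"
    and T :: "nat \<Rightarrow> 'a \<Rightarrow> 'a"
    and P :: "nat \<Rightarrow> nat \<Rightarrow> real_mpoly"
    and p :: "nat \<Rightarrow> real"
    and \<O> :: "(nat \<Rightarrow> real) \<Rightarrow> ennreal"
  assumes "d \<ge> 1" and "m \<ge> 1" and "k \<ge> 1"
    and "mp_system M d T"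
    and "\<And>i j. i \<in> {1..d} \<Longrightarrow> j \<in> {1..m} \<Longrightarrow> poly_in_vars k (P i j) \<and> integer_valued (P i j)"
    and "\<And>j. j \<in> {0..m} \<Longrightarrow> p j > 0"
    and "(\<Sum>j \<in> {1..m}. 1 / p j) = 1 / p 0"
    and "finitary_limit \<O>"
  shows "strong_constant \<O> M d T m k P p
           \<le> strong_constant \<O> (canonical_measure d) d canonical_shift m k P p
         \<and> weak_constant \<O> M d T m k P p
           \<le> weak_constant \<O> (canonical_measure d) d canonical_shift m k P p"
proof
  have p0: "p 0 > 0" using assms(6) by simp
  have bound: "ennpow (ennreal c * (\<Prod>j\<in>{1..m}. Lp_norm N (p j) (f j))) (p 0) =
      ennreal (c powr p 0) * (\<Prod>j\<in>{1..m}. ennpow (Lp_norm N (p j) (f j)) (p 0))"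
    if "0 \<le> c" for c and N :: "'b measure" and f
    using that p0 by (simp add: ennpow_mult ennpow_prod ennpow_ennreal)
  show "strong_constant \<O> M d T m k P p
      \<le> strong_constant \<O> (canonical_measure d) d canonical_shift m k P p"
    unfolding strong_constant_def
  proof (rule optimal_constant_mono_of_transfer)
    fix c :: real and f
    assume c: "0 \<le> c" and f: "\<And>j. j \<in> {1..m} \<Longrightarrow> f j \<in> Lp_space M (p j)"
      and can: "\<And>f. (\<And>j. j \<in> {1..m} \<Longrightarrow> f j \<in> Lp_space (canonical_measure d) (p j)) \<Longrightarrow>
        strong_norm (canonical_measure d) (p 0)
            (\<lambda>x. \<O> (\<lambda>N. poly_average (canonical_measure d) d canonical_shift m k P f N x))
          \<le> ennreal c * (\<Prod>j\<in>{1..m}. Lp_norm (canonical_measure d) (p j) (f j))"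
    show "strong_norm M (p 0) (\<lambda>x. \<O> (\<lambda>N. poly_average M d T m k P f N x))
        \<le> ennreal c * (\<Prod>j\<in>{1..m}. Lp_norm M (p j) (f j))"
      unfolding strong_norm_le_iff[OF p0] bound[OF c]
      using can unfolding strong_norm_le_iff[OF p0] bound[OF c]
      by (intro transference[OF assms(4,8,6,7)] f monoI ennpow_mono ennpow_le_liminf p0
          borel_measurable_ennpow powr_ge_zero) auto
  qed
  have meas: "(\<lambda>x. \<O> (\<lambda>N. poly_average M d T m k P f N x)) \<in> borel_measurable M"
    if f: "\<And>j. j \<in> {1..m} \<Longrightarrow> f j \<in> Lp_space M (p j)" for f
  proof -
    have "poly_average M d T m k P f N \<in> borel_measurable M" for N
      using assms(4) f by (intro borel_measurable_poly_average) (auto simp: mp_system_def Lp_space_def)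
    then show ?thesis by (rule borel_measurable_finitary_limit[OF assms(8)])
  qed
  show "weak_constant \<O> M d T m k P p
      \<le> weak_constant \<O> (canonical_measure d) d canonical_shift m k P p"
    unfolding weak_constant_def
  proof (rule optimal_constant_mono_of_transfer)
    fix c :: real and f
    assume c: "0 \<le> c" and f: "\<And>j. j \<in> {1..m} \<Longrightarrow> f j \<in> Lp_space M (p j)"
      and can: "\<And>f. (\<And>j. j \<in> {1..m} \<Longrightarrow> f j \<in> Lp_space (canonical_measure d) (p j)) \<Longrightarrow>
        weak_norm (canonical_measure d) (p 0)
            (\<lambda>x. \<O> (\<lambda>N. poly_average (canonical_measure d) d canonical_shift m k P f N x))
          \<le> ennreal c * (\<Prod>j\<in>{1..m}. Lp_norm (canonical_measure d) (p j) (f j))"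
    have can': "g \<in> borel_measurable (canonical_measure d)" for g :: "(nat \<Rightarrow> int) \<Rightarrow> ennreal"
      by (simp add: canonical_measure_def)
    have "(\<integral>\<^sup>+x. weak_gauge (p 0) t (\<O> (\<lambda>N. poly_average M d T m k P f N x)) \<partial>M)
        \<le> ennreal (c powr p 0) * (\<Prod>j\<in>{1..m}. ennpow (Lp_norm M (p j) (f j)) (p 0))" if "t > 0" for t
    proof (rule transference[OF assms(4,8,6,7)])
      show "weak_gauge (p 0) t \<in> borel_measurable borel"
        unfolding weak_gauge_def[abs_def] by measurable
      show "mono (weak_gauge (p 0) t)"
        by (auto simp: weak_gauge_def mono_def indicator_def)
      show "(\<integral>\<^sup>+l. weak_gauge (p 0) t
            (\<O> (\<lambda>N. poly_average (canonical_measure d) d canonical_shift m k P g N l)) \<partial>canonical_measure d)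
          \<le> ennreal (c powr p 0) * (\<Prod>j\<in>{1..m}. ennpow (Lp_norm (canonical_measure d) (p j) (g j)) (p 0))"
        if "\<And>j. j \<in> {1..m} \<Longrightarrow> g j \<in> Lp_space (canonical_measure d) (p j)" for g
        using can[OF that] \<open>t > 0\<close> unfolding weak_norm_le_iff[OF p0 can'] bound[OF c] by blast
      show "weak_gauge (p 0) t y \<le> liminf (\<lambda>n. weak_gauge (p 0) t (u n))" if "u \<longlonglongrightarrow> y" for u y
        using that by (rule weak_gauge_le_liminf)
    qed (simp_all add: f)
    moreover have "(\<lambda>x. \<O> (\<lambda>N. poly_average M d T m k P f N x)) \<in> borel_measurable M"
      using f by (rule meas)
    ultimately show "weak_norm M (p 0) (\<lambda>x. \<O> (\<lambda>N. poly_average M d T m k P f N x))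
        \<le> ennreal c * (\<Prod>j\<in>{1..m}. Lp_norm M (p j) (f j))"
      by (simp add: weak_norm_le_iff[OF p0] bound[OF c] del: One_nat_def)
  qed
qed

end
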